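(* Let $V=\frac{\partial}{\partial x^3}$ and $\eta=dx^3$, and let $\lambda,\mu$ be smooth functions on $I$ with $\mu$ not identically zero. If $f_1,f_2$ depend only on $x^3$, then $(I,\tilde g,V,\lambda,\mu)$ is an almost $\eta$-Ricci soliton if and only if $$\lambda=\frac{f_1'}{f_1}\left(\frac{f_2'}{f_2}+1\right)-\frac{f_1''}{f_1}+2\left(\frac{f_1'}{f_1}\right)^2,\qquad \mu=-\frac{f_1'}{f_1}\left(\frac{f_2'}{f_2}+1\right)-\frac{f_2''}{f_2}+2\left(\frac{f_2'}{f_2}\right)^2,$$ and $f_1$ and $f_2$ satisfy $$\frac{f_1''-f_1'}{f_1}-2\left(\frac{f_1'}{f_1}\right)^2=\frac{f_2''-f_2'}{f_2}-2\left(\frac{f_2'}{f_2}\right)^2.$$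
   Context: Let $I=I_1\times I_2\times I_3\subseteq\mathbb R^3$ with $I_1,I_2,I_3\subseteq\mathbb R$ open intervals and standard coordinates $x^1,x^2,x^3$. Let $f_1,f_2$ be smooth nowhere zero functions on $I$ and endow $I$ with the Riemannian metric $\tilde g=\frac{1}{f_1^2}dx^1\otimes dx^1+\frac{1}{f_2^2}dx^2\otimes dx^2+dx^3\otimes dx^3$, with orthonormal frame $E_1=f_1\frac{\partial}{\partial x^1}$, $E_2=f_2\frac{\partial}{\partial x^2}$, $E_3=\frac{\partial}{\partial x^3}$. For a smooth vector field $V$, a $1$-form $\eta$, and smooth functions $\lambda,\mu$ on $I$ with $\mu\neq0$ (not identically zero), $(I,\tilde g,V,\lambda,\mu)$ is an almost $\eta$-Ricci soliton if $\frac12\pounds_V\tilde g+\mathrm{Ric}+\lambda\tilde g+\mu\,\eta\otimes\eta=0$ on $I$, where $\pounds_V\tilde g$ is the Lie derivative of $\tilde g$ along $V$ and $\mathrm{Ric}$ is the Ricci tensor of $\tilde g$, with $\mathrm{Ric}(Y,Z)=\sum_{k}\tilde g(R(E_k,Y)Z,E_k)$, $R(X,Y)Z=\nabla_X\nabla_YZ-\nabla_Y\nabla_XZ-\nabla_{[X,Y]}Z$, $\nabla$ the Levi-Civita connection. A prime denotes the derivative with respect to $x^3$. *)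

theory Defs
  imports "HOL-Analysis.Analysis"
begin

(* Only used for open S, where the total derivative at a point of S depends on f
   restricted to S. *)
primrec Ck_on :: "nat \<Rightarrow> 'a::real_normed_vector set \<Rightarrow> ('a \<Rightarrow> 'b::real_normed_vector) \<Rightarrow> bool" where
  "Ck_on 0 S f \<longleftrightarrow> continuous_on S f"
| "Ck_on (Suc k) S f \<longleftrightarrow>
     (\<forall>x\<in>S. f differentiable at x) \<and> (\<forall>v. Ck_on k S (\<lambda>x. frechet_derivative f (at x) v))"

definition smooth_on :: "'a::real_normed_vector set \<Rightarrow> ('a \<Rightarrow> 'b::real_normed_vector) \<Rightarrow> bool" where
  "smooth_on S f \<longleftrightarrow> (\<forall>k. Ck_on k S f)"

(* Tensor fields on an open subset S of R^n, in standard coordinates.  All fields are total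
   functions; only their values on S matter. *)
type_synonym 'n vfield = "real ^ 'n \<Rightarrow> real ^ 'n"
type_synonym 'n form1 = "real ^ 'n \<Rightarrow> real ^ 'n \<Rightarrow> real"
type_synonym 'n tensor2 = "real ^ 'n \<Rightarrow> real ^ 'n \<Rightarrow> real ^ 'n \<Rightarrow> real"
type_synonym 'n conn = "'n vfield \<Rightarrow> 'n vfield \<Rightarrow> 'n vfield"

definition coord_vf :: "'n \<Rightarrow> ('n::finite) vfield" where
  "coord_vf i = (\<lambda>x. axis i 1)"

definition dx :: "'n \<Rightarrow> ('n::finite) form1" where
  "dx i = (\<lambda>x v. v $ i)"

definition tensor_prod :: "('n::finite) form1 \<Rightarrow> 'n form1 \<Rightarrow> 'n tensor2" where
  "tensor_prod \<alpha> \<beta> = (\<lambda>x u v. \<alpha> x u * \<beta> x v)"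

definition smooth_form1 :: "(real ^ 'n) set \<Rightarrow> ('n::finite) form1 \<Rightarrow> bool" where
  "smooth_form1 S \<eta> \<longleftrightarrow> (\<forall>x\<in>S. linear (\<eta> x)) \<and> (\<forall>v. smooth_on S (\<lambda>x. \<eta> x v))"

definition riemannian_metric :: "(real ^ 'n) set \<Rightarrow> ('n::finite) tensor2 \<Rightarrow> bool" where
  "riemannian_metric S g \<longleftrightarrow>
     (\<forall>x\<in>S. bilinear (g x) \<and> (\<forall>u v. g x u v = g x v u) \<and> (\<forall>v. v \<noteq> 0 \<longrightarrow> 0 < g x v v)) \<and>
     (\<forall>u v. smooth_on S (\<lambda>x. g x u v))"

definition orthonormal_frame ::
  "(real ^ 'n) set \<Rightarrow> ('n::finite) tensor2 \<Rightarrow> ('n \<Rightarrow> 'n vfield) \<Rightarrow> bool" where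
  "orthonormal_frame S g E \<longleftrightarrow>
     (\<forall>i. smooth_on S (E i)) \<and>
     (\<forall>x\<in>S. \<forall>i j. g x (E i x) (E j x) = (if i = j then 1 else 0))"

(* The function X(f). *)
definition vf_apply ::
  "('n::finite) vfield \<Rightarrow> (real ^ 'n \<Rightarrow> 'b::real_normed_vector) \<Rightarrow> real ^ 'n \<Rightarrow> 'b" where
  "vf_apply X f = (\<lambda>x. frechet_derivative f (at x) (X x))"

(* The i-th component of [X,Y] is X(Y^i) - Y(X^i). *)
definition lie_bracket :: "('n::finite) vfield \<Rightarrow> 'n vfield \<Rightarrow> 'n vfield" where
  "lie_bracket X Y = (\<lambda>x. vf_apply X Y x - vf_apply Y X x)"

definition lie_derivative ::
  "('n::finite) vfield \<Rightarrow> 'n tensor2 \<Rightarrow> 'n vfield \<Rightarrow> 'n vfield \<Rightarrow> real ^ 'n \<Rightarrow> real" where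
  "lie_derivative V g Y Z = (\<lambda>x.
     vf_apply V (\<lambda>y. g y (Y y) (Z y)) x
     - g x (lie_bracket V Y x) (Z x) - g x (Y x) (lie_bracket V Z x))"

definition affine_connection :: "(real ^ 'n) set \<Rightarrow> ('n::finite) conn \<Rightarrow> bool" where
  "affine_connection S nabla \<longleftrightarrow>
     (\<forall>X Y. smooth_on S X \<longrightarrow> smooth_on S Y \<longrightarrow> smooth_on S (nabla X Y)) \<and>
     (\<forall>X X' Y. smooth_on S X \<longrightarrow> smooth_on S X' \<longrightarrow> smooth_on S Y \<longrightarrow>
        (\<forall>x\<in>S. nabla (\<lambda>y. X y + X' y) Y x = nabla X Y x + nabla X' Y x)) \<and>
     (\<forall>f X Y. smooth_on S f \<longrightarrow> smooth_on S X \<longrightarrow> smooth_on S Y \<longrightarrow>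
        (\<forall>x\<in>S. nabla (\<lambda>y. f y *\<^sub>R X y) Y x = f x *\<^sub>R nabla X Y x)) \<and>
     (\<forall>X Y Y'. smooth_on S X \<longrightarrow> smooth_on S Y \<longrightarrow> smooth_on S Y' \<longrightarrow>
        (\<forall>x\<in>S. nabla X (\<lambda>y. Y y + Y' y) x = nabla X Y x + nabla X Y' x)) \<and>
     (\<forall>f X Y. smooth_on S f \<longrightarrow> smooth_on S X \<longrightarrow> smooth_on S Y \<longrightarrow>
        (\<forall>x\<in>S. nabla X (\<lambda>y. f y *\<^sub>R Y y) x = vf_apply X f x *\<^sub>R Y x + f x *\<^sub>R nabla X Y x))"

definition is_levi_civita :: "(real ^ 'n) set \<Rightarrow> ('n::finite) tensor2 \<Rightarrow> 'n conn \<Rightarrow> bool" where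
  "is_levi_civita S g nabla \<longleftrightarrow>
     affine_connection S nabla \<and>
     (\<forall>X Y. smooth_on S X \<longrightarrow> smooth_on S Y \<longrightarrow>
        (\<forall>x\<in>S. nabla X Y x - nabla Y X x = lie_bracket X Y x)) \<and>
     (\<forall>X Y Z. smooth_on S X \<longrightarrow> smooth_on S Y \<longrightarrow> smooth_on S Z \<longrightarrow>
        (\<forall>x\<in>S. vf_apply X (\<lambda>y. g y (Y y) (Z y)) x
               = g x (nabla X Y x) (Z x) + g x (Y x) (nabla X Z x)))"

(* For a Riemannian metric on an open set, is_levi_civita determines nabla X Y on S for all
   X, Y smooth on S, so the choice below only concerns irrelevant values: points outside S
   and fields that are not smooth on S. *)
definition levi_civita :: "(real ^ 'n) set \<Rightarrow> ('n::finite) tensor2 \<Rightarrow> 'n conn" where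
  "levi_civita S g = (SOME nabla. is_levi_civita S g nabla)"

definition curvature :: "('n::finite) conn \<Rightarrow> 'n vfield \<Rightarrow> 'n vfield \<Rightarrow> 'n vfield \<Rightarrow> 'n vfield" where
  "curvature nabla X Y Z = (\<lambda>x.
     nabla X (nabla Y Z) x - nabla Y (nabla X Z) x - nabla (lie_bracket X Y) Z x)"

(* E is meant to be a g-orthonormal frame on S. *)
definition ricci ::
  "(real ^ 'n) set \<Rightarrow> ('n::finite) tensor2 \<Rightarrow> ('n \<Rightarrow> 'n vfield) \<Rightarrow>
   'n vfield \<Rightarrow> 'n vfield \<Rightarrow> real ^ 'n \<Rightarrow> real" where
  "ricci S g E Y Z = (\<lambda>x.
     \<Sum>k\<in>UNIV. g x (curvature (levi_civita S g) (E k) Y Z x) (E k x))"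

definition almost_eta_ricci_soliton ::
  "(real ^ 'n) set \<Rightarrow> ('n::finite) tensor2 \<Rightarrow> ('n \<Rightarrow> 'n vfield) \<Rightarrow>
   'n vfield \<Rightarrow> 'n form1 \<Rightarrow> (real ^ 'n \<Rightarrow> real) \<Rightarrow> (real ^ 'n \<Rightarrow> real) \<Rightarrow> bool" where
  "almost_eta_ricci_soliton S g E V \<eta> lam mu \<longleftrightarrow>
     riemannian_metric S g \<and> orthonormal_frame S g E \<and>
     smooth_on S V \<and> smooth_form1 S \<eta> \<and> smooth_on S lam \<and> smooth_on S mu \<and>
     (\<exists>x\<in>S. mu x \<noteq> 0) \<and>
     (\<forall>Y Z. smooth_on S Y \<longrightarrow> smooth_on S Z \<longrightarrow>
        (\<forall>x\<in>S. 1 / 2 * lie_derivative V g Y Z x + ricci S g E Y Z x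
               + lam x * g x (Y x) (Z x) + mu x * tensor_prod \<eta> \<eta> x (Y x) (Z x) = 0))"

definition box3 :: "real set \<Rightarrow> real set \<Rightarrow> real set \<Rightarrow> (real ^ 3) set" where
  "box3 I1 I2 I3 = {x. x $ 1 \<in> I1 \<and> x $ 2 \<in> I2 \<and> x $ 3 \<in> I3}"

definition metric3 :: "(real ^ 3 \<Rightarrow> real) \<Rightarrow> (real ^ 3 \<Rightarrow> real) \<Rightarrow> 3 tensor2" where
  "metric3 f1 f2 = (\<lambda>x u v.
     1 / (f1 x)\<^sup>2 * tensor_prod (dx 1) (dx 1) x u v
     + 1 / (f2 x)\<^sup>2 * tensor_prod (dx 2) (dx 2) x u v
     + tensor_prod (dx 3) (dx 3) x u v)"

definition frame3 :: "(real ^ 3 \<Rightarrow> real) \<Rightarrow> (real ^ 3 \<Rightarrow> real) \<Rightarrow> 3 \<Rightarrow> 3 vfield" where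
  "frame3 f1 f2 k = (\<lambda>x.
     if k = 1 then f1 x *\<^sub>R coord_vf 1 x
     else if k = 2 then f2 x *\<^sub>R coord_vf 2 x
     else coord_vf 3 x)"

definition d3 :: "(real ^ 3 \<Rightarrow> real) \<Rightarrow> real ^ 3 \<Rightarrow> real" where
  "d3 f = vf_apply (coord_vf 3) f"

definition depends_only_on_x3 :: "(real ^ 3) set \<Rightarrow> (real ^ 3 \<Rightarrow> real) \<Rightarrow> bool" where
  "depends_only_on_x3 S f \<longleftrightarrow> (\<forall>x\<in>S. \<forall>y\<in>S. x $ 3 = y $ 3 \<longrightarrow> f x = f y)"

end

(* Write p = f1'/f1, q = f2'/f2, a = 1/f1^2, b = 1/f2^2.  Since f1 and f2 depend only on x^3,
   every vector field X acts on them by X(f) = X^3 f', so a' = -2pa and b' = -2qb, and the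
   Christoffel symbols are polynomials in p, q, a, b.  The connection D_X Y + Gamma(X,Y) is
   metric and torsion free, and the Levi-Civita connection is unique on smooth fields, so its
   curvature may be computed from this formula; second derivatives of the arguments cancel by
   [X,Y] = XY - YX, which is the symmetry of second derivatives.  One finds
     Ric = (p' - p^2 - pq) a dx1 dx1 + (q' - q^2 - pq) b dx2 dx2 + (p' - p^2 + q' - q^2) dx3 dx3,
     (1/2) L_V g = - p a dx1 dx1 - q b dx2 dx2.
   So the soliton equation is diagonal, and its three diagonal entries are equivalent to the
   formulas for lambda and mu and the compatibility condition. *)
theory Submission
  imports Defs
begin

section \<open>Smooth functions and symmetry of second derivatives\<close>

text \<open>Being a derivative at a point of an open set depends only on values in that set, so both
  choices are made from the same predicate; this covers points without a derivative too.\<close>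

lemma frechet_derivative_cong_open:
  assumes "open S" "x \<in> S" "\<And>y. y \<in> S \<Longrightarrow> f y = g y"
  shows "frechet_derivative f (at x) = frechet_derivative g (at x)"
proof -
  have "(f has_derivative D) (at x) \<longleftrightarrow> (g has_derivative D) (at x)" for D
    using has_derivative_transform_within_open[of f D x UNIV S g]
      has_derivative_transform_within_open[of g D x UNIV S f] assms by auto
  then show ?thesis
    by (simp add: frechet_derivative_def)
qed

lemma frechet_derivative_eqI:
  "(f has_derivative D) (at x) \<Longrightarrow> frechet_derivative f (at x) v = D v"
  by (metis frechet_derivative_at)

text \<open>The calculus rules below identify derivatives only at points of \<open>S\<close>,
  whereas \<open>Ck_on\<close> speaks of total functions; this bridges the two at every inductive
  step.\<close>

lemma Ck_on_cong:
  assumes "open S" "\<And>x. x \<in> S \<Longrightarrow> f x = g x" "Ck_on k S f"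
  shows "Ck_on k S g"
  using assms(2,3)
proof (induction k arbitrary: f g)
  case 0
  then show ?case by (metis Ck_on.simps(1) continuous_on_cong)
next
  case (Suc k)
  have fd: "f differentiable at x" if "x \<in> S" for x
    using Suc.prems(2) that by simp
  have gd: "g differentiable at x" if "x \<in> S" for x
    using has_derivative_transform_within_open[of f _ x UNIV S g] fd[OF that] that assms(1) Suc.prems(1)
    unfolding differentiable_def by blast
  have "Ck_on k S (\<lambda>x. frechet_derivative g (at x) v)" for v
  proof (rule Suc.IH)
    show "Ck_on k S (\<lambda>x. frechet_derivative f (at x) v)"
      using Suc.prems(2) by simp
    show "frechet_derivative f (at x) v = frechet_derivative g (at x) v" if "x \<in> S" for x
      using frechet_derivative_cong_open[of S x f g] assms(1) that Suc.prems(1) by simp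
  qed
  with gd show ?case by simp
qed

lemma Ck_on_SucD: "Ck_on (Suc k) S f \<Longrightarrow> Ck_on k S f"
proof (induction k arbitrary: f)
  case 0
  then show ?case
    by (auto intro!: continuous_at_imp_continuous_on differentiable_imp_continuous_within)
next
  case (Suc k)
  have "Ck_on k S (\<lambda>x. frechet_derivative f (at x) v)" for v
    using Suc.prems by (intro Suc.IH) simp
  then show ?case using Suc.prems by simp
qed

lemma Ck_on_const: "Ck_on k S (\<lambda>x. c)"
  by (induction k arbitrary: c) auto

lemma Ck_on_add:
  assumes "open S" "Ck_on k S f" "Ck_on k S g"
  shows "Ck_on k S (\<lambda>x. f x + g x)"
  using assms(2,3)
proof (induction k arbitrary: f g)
  case 0
  then show ?case by (simp add: continuous_on_add)
next
  case (Suc k)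
  have "Ck_on k S (\<lambda>x. frechet_derivative (\<lambda>y. f y + g y) (at x) v)" for v
  proof (rule Ck_on_cong[OF assms(1)])
    show "Ck_on k S (\<lambda>x. frechet_derivative f (at x) v + frechet_derivative g (at x) v)"
      using Suc.prems by (intro Suc.IH) simp_all
    show "frechet_derivative f (at x) v + frechet_derivative g (at x) v
        = frechet_derivative (\<lambda>y. f y + g y) (at x) v" if "x \<in> S" for x
      using Suc.prems that
      by (intro frechet_derivative_eqI[symmetric] has_derivative_add)
        (simp_all add: frechet_derivative_works)
  qed
  with Suc.prems show ?case by simp
qed

text \<open>By the product rule the derivative is a sum of two \<open>B\<close>-terms, each with one
  factor differentiated and the other lowered by \<open>Ck_on_SucD\<close>, so the induction closes.
  A general \<open>B\<close> yields both products and scalar multiples.\<close>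

lemma Ck_on_bilinear:
  assumes "bounded_bilinear B" "open S" "Ck_on k S f" "Ck_on k S g"
  shows "Ck_on k S (\<lambda>x. B (f x) (g x))"
  using assms(3,4)
proof (induction k arbitrary: f g)
  case 0
  then show ?case
    using bounded_bilinear.continuous_on[OF assms(1)] by simp
next
  case (Suc k)
  have hd: "((\<lambda>y. B (f y) (g y)) has_derivative
      (\<lambda>v. B (f x) (frechet_derivative g (at x) v) + B (frechet_derivative f (at x) v) (g x))) (at x)"
    if "x \<in> S" for x
    using Suc.prems that
    by (intro bounded_bilinear.FDERIV[OF assms(1)]) (simp_all add: frechet_derivative_works)
  have "Ck_on k S (\<lambda>x. frechet_derivative (\<lambda>y. B (f y) (g y)) (at x) v)" for v
  proof (rule Ck_on_cong[OF assms(2)])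
    show "Ck_on k S (\<lambda>x. B (f x) (frechet_derivative g (at x) v) + B (frechet_derivative f (at x) v) (g x))"
      using Suc.prems Suc.prems[THEN Ck_on_SucD] by (intro Ck_on_add[OF assms(2)] Suc.IH) simp_all
    show "B (f x) (frechet_derivative g (at x) v) + B (frechet_derivative f (at x) v) (g x)
        = frechet_derivative (\<lambda>y. B (f y) (g y)) (at x) v" if "x \<in> S" for x
      using frechet_derivative_eqI[OF hd[OF that]] by simp
  qed
  with hd show ?case by (auto simp: differentiable_def)
qed

text \<open>The derivative of 1/f is -(1/f) f' (1/f). The induction hypothesis for 1/f, one order
  lower, combines with closure under products.\<close>

lemma Ck_on_inverse:
  fixes f :: "'a::real_normed_vector \<Rightarrow> real"
  assumes "open S" "Ck_on k S f" "\<And>x. x \<in> S \<Longrightarrow> f x \<noteq> 0"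
  shows "Ck_on k S (\<lambda>x. inverse (f x))"
  using assms(2)
proof (induction k)
  case 0
  then show ?case using assms(3) by (simp add: continuous_on_inverse)
next
  case (Suc k)
  have hd: "((\<lambda>y. inverse (f y)) has_derivative
      (\<lambda>v. - (inverse (f x) * frechet_derivative f (at x) v * inverse (f x)))) (at x)"
    if "x \<in> S" for x
    using Suc.prems that assms(3)
    by (intro Deriv.has_derivative_inverse) (simp_all add: frechet_derivative_works)
  have "Ck_on k S (\<lambda>x. frechet_derivative (\<lambda>y. inverse (f y)) (at x) v)" for v
  proof (rule Ck_on_cong[OF assms(1)])
    show "Ck_on k S (\<lambda>x. (-1) * ((inverse (f x) * frechet_derivative f (at x) v) * inverse (f x)))"
      using Suc.prems Suc.IH[OF Ck_on_SucD[OF Suc.prems]]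
      by (intro Ck_on_bilinear[OF bounded_bilinear_mult assms(1)] Ck_on_const) simp_all
    show "(-1) * ((inverse (f x) * frechet_derivative f (at x) v) * inverse (f x))
        = frechet_derivative (\<lambda>y. inverse (f y)) (at x) v" if "x \<in> S" for x
      using frechet_derivative_eqI[OF hd[OF that]] by simp
  qed
  with hd show ?case by (auto simp: differentiable_def)
qed

lemma smooth_on_cong:
  "open S \<Longrightarrow> (\<And>x. x \<in> S \<Longrightarrow> f x = g x) \<Longrightarrow> smooth_on S f \<Longrightarrow> smooth_on S g"
  unfolding smooth_on_def using Ck_on_cong by blast

lemma smooth_on_const: "smooth_on S (\<lambda>x. c)"
  by (simp add: smooth_on_def Ck_on_const)

lemma smooth_on_add:
  "open S \<Longrightarrow> smooth_on S f \<Longrightarrow> smooth_on S g \<Longrightarrow> smooth_on S (\<lambda>x. f x + g x)"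
  by (simp add: smooth_on_def Ck_on_add)

lemma smooth_on_sum:
  "open S \<Longrightarrow> (\<And>i. i \<in> A \<Longrightarrow> smooth_on S (f i)) \<Longrightarrow> smooth_on S (\<lambda>x. \<Sum>i\<in>A. f i x)"
  by (induction A rule: infinite_finite_induct) (auto intro: smooth_on_const smooth_on_add)

lemma smooth_on_bilinear:
  "bounded_bilinear B \<Longrightarrow> open S \<Longrightarrow> smooth_on S f \<Longrightarrow> smooth_on S g
    \<Longrightarrow> smooth_on S (\<lambda>x. B (f x) (g x))"
  by (simp add: smooth_on_def Ck_on_bilinear)

lemmas smooth_on_mult = smooth_on_bilinear[OF bounded_bilinear_mult]
lemmas smooth_on_scaleR = smooth_on_bilinear[OF bounded_bilinear_scaleR]

lemma smooth_on_bounded_linear: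
  assumes "bounded_linear h" "open S" "smooth_on S f"
  shows "smooth_on S (\<lambda>x. h (f x))"
proof -
  \<comment> \<open>A linear map becomes a bilinear one through an extra scalar factor, which is
    then fixed to 1.\<close>
  have "bounded_bilinear (\<lambda>(r::real) y. r *\<^sub>R h y)"
    using bounded_bilinear.comp[OF bounded_bilinear_scaleR bounded_linear_ident assms(1)] .
  from smooth_on_bilinear[OF this assms(2) smooth_on_const[of S 1] assms(3)]
  show ?thesis by simp
qed

lemma smooth_on_minus: "open S \<Longrightarrow> smooth_on S f \<Longrightarrow> smooth_on S (\<lambda>x. - f x)"
  by (rule smooth_on_bounded_linear[OF bounded_linear_minus[OF bounded_linear_ident]])

lemma smooth_on_diff:
  "open S \<Longrightarrow> smooth_on S f \<Longrightarrow> smooth_on S g \<Longrightarrow> smooth_on S (\<lambda>x. f x - g x)"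
  using smooth_on_add[of S f "\<lambda>x. - g x"] smooth_on_minus[of S g] by simp

lemma smooth_on_power:
  fixes f :: "'a::real_normed_vector \<Rightarrow> real"
  shows "open S \<Longrightarrow> smooth_on S f \<Longrightarrow> smooth_on S (\<lambda>x. f x ^ n)"
  by (induction n) (auto intro: smooth_on_const smooth_on_mult)

lemma smooth_on_divide:
  fixes f g :: "'a::real_normed_vector \<Rightarrow> real"
  assumes "open S" "smooth_on S f" "smooth_on S g" "\<And>x. x \<in> S \<Longrightarrow> g x \<noteq> 0"
  shows "smooth_on S (\<lambda>x. f x / g x)"
proof -
  have "smooth_on S (\<lambda>x. inverse (g x))"
    using assms by (simp add: smooth_on_def Ck_on_inverse)
  from smooth_on_mult[OF assms(1,2) this] show ?thesis
    by (simp add: divide_inverse)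
qed

lemma smooth_on_vec_nth: "open S \<Longrightarrow> smooth_on S X \<Longrightarrow> smooth_on S (\<lambda>x. X x $ i)"
  by (rule smooth_on_bounded_linear[OF bounded_linear_vec_nth])

lemma smooth_on_vec:
  fixes X :: "'a::real_normed_vector \<Rightarrow> real ^ 'n"
  assumes "open S" "\<And>i. smooth_on S (\<lambda>x. X x $ i)"
  shows "smooth_on S X"
proof -
  have "smooth_on S (\<lambda>x. \<Sum>i\<in>UNIV. X x $ i *\<^sub>R axis i (1::real))"
    using assms by (intro smooth_on_sum smooth_on_scaleR smooth_on_const)
  then show ?thesis
    by (simp add: basis_expansion flip: scalar_mult_eq_scaleR)
qed

lemma smooth_on_imp_differentiable:
  "smooth_on S f \<Longrightarrow> x \<in> S \<Longrightarrow> f differentiable at x"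
  unfolding smooth_on_def by (metis Ck_on.simps(2))

lemma smooth_on_imp_continuous_on: "smooth_on S f \<Longrightarrow> continuous_on S f"
  unfolding smooth_on_def by (metis Ck_on.simps(1))

lemma smooth_on_frechet_derivative:
  "smooth_on S f \<Longrightarrow> smooth_on S (\<lambda>x. frechet_derivative f (at x) v)"
  unfolding smooth_on_def by (metis Ck_on.simps(2))

lemma frechet_derivative_vec_expand:
  assumes "f differentiable at x"
  shows "frechet_derivative f (at x) v
    = (\<Sum>i\<in>UNIV. v $ i *\<^sub>R frechet_derivative f (at x) (axis i 1))"
proof -
  interpret linear "frechet_derivative f (at x)"
    by (rule linear_frechet_derivative[OF assms])
  have "v = (\<Sum>i\<in>UNIV. v $ i *\<^sub>R axis i 1)"
    by (simp add: basis_expansion flip: scalar_mult_eq_scaleR)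
  then have "frechet_derivative f (at x) v
    = frechet_derivative f (at x) (\<Sum>i\<in>UNIV. v $ i *\<^sub>R axis i 1)" by simp
  then show ?thesis by (simp add: sum scale)
qed

text \<open>\<open>Ck_on\<close> controls derivatives in a fixed direction only, but here the
  direction \<open>X x\<close> varies with the point. Expansion in the standard basis writes X(f) as
  a sum of products of smooth functions.\<close>

lemma smooth_on_vf_apply:
  assumes "open S" "smooth_on S X" "smooth_on S f"
  shows "smooth_on S (vf_apply X f)"
proof (rule smooth_on_cong[OF assms(1)])
  show "smooth_on S (\<lambda>x. \<Sum>i\<in>UNIV. X x $ i *\<^sub>R frechet_derivative f (at x) (axis i 1))"
    using assms
    by (intro smooth_on_sum smooth_on_scaleR smooth_on_vec_nth smooth_on_frechet_derivative)
  show "(\<Sum>i\<in>UNIV. X x $ i *\<^sub>R frechet_derivative f (at x) (axis i 1)) = vf_apply X f x"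
    if "x \<in> S" for x
    using frechet_derivative_vec_expand[OF smooth_on_imp_differentiable[OF assms(3) that], of "X x"]
    by (simp add: vf_apply_def)
qed

section \<open>Symmetry of second derivatives\<close>

text \<open>Two applications of the mean value theorem: first along \<open>u\<close> to the
  difference of \<open>f\<close> on the two sides of the parallelogram parallel to \<open>u\<close>,
  then along \<open>v\<close> to the derivative of \<open>f\<close> in direction \<open>u\<close>.
  The bound on \<open>h\<close> keeps the parallelogram in the ball.\<close>

lemma second_difference_mvt:
  fixes f :: "'a::real_normed_vector \<Rightarrow> real"
  assumes f: "\<And>y. y \<in> ball x d \<Longrightarrow> f differentiable at y"
    and df: "\<And>y. y \<in> ball x d \<Longrightarrow> (\<lambda>z. frechet_derivative f (at z) u) differentiable at y"
    and h: "0 < h" "h * (norm u + norm v) < d"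
  obtains y where "y \<in> ball x d"
    "f (x + h *\<^sub>R u + h *\<^sub>R v) - f (x + h *\<^sub>R u) - f (x + h *\<^sub>R v) + f x
      = h\<^sup>2 * frechet_derivative (\<lambda>z. frechet_derivative f (at z) u) (at y) v"
proof -
  define g where "g = (\<lambda>z. frechet_derivative f (at z) u)"
  have in_ball: "x + s *\<^sub>R u + t *\<^sub>R v \<in> ball x d" if "0 \<le> s" "s \<le> h" "0 \<le> t" "t \<le> h" for s t
  proof -
    have "norm (s *\<^sub>R u + t *\<^sub>R v) \<le> s * norm u + t * norm v"
      using norm_triangle_ineq[of "s *\<^sub>R u" "t *\<^sub>R v"] that by simp
    also have "\<dots> \<le> h * norm u + h * norm v"
      using that by (intro add_mono mult_right_mono) auto
    finally show ?thesis
      using h dist_norm[of "x + s *\<^sub>R u + t *\<^sub>R v" x] by (simp add: dist_commute algebra_simps)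
  qed
  have df': "((\<lambda>s. f (a + s *\<^sub>R u)) has_real_derivative g (a + s *\<^sub>R u)) (at s)"
    if "a + s *\<^sub>R u \<in> ball x d" for a s
  proof -
    have "((\<lambda>s. f (a + s *\<^sub>R u)) has_derivative
        (\<lambda>r. frechet_derivative f (at (a + s *\<^sub>R u)) (r *\<^sub>R u))) (at s)"
      by (rule has_derivative_compose[of "\<lambda>s. a + s *\<^sub>R u"])
        (use f[OF that] in \<open>auto intro!: derivative_eq_intros simp: frechet_derivative_works\<close>)
    moreover have "frechet_derivative f (at (a + s *\<^sub>R u)) (r *\<^sub>R u) = g (a + s *\<^sub>R u) * r" for r
      using linear_frechet_derivative[OF f[OF that]] by (simp add: linear_scale g_def)
    ultimately show ?thesis
      by (simp add: has_field_derivative_def)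
  qed
  have dg: "((\<lambda>t. g (a + t *\<^sub>R v)) has_real_derivative frechet_derivative g (at (a + t *\<^sub>R v)) v) (at t)"
    if "a + t *\<^sub>R v \<in> ball x d" for a t
  proof -
    have "((\<lambda>t. g (a + t *\<^sub>R v)) has_derivative
        (\<lambda>r. frechet_derivative g (at (a + t *\<^sub>R v)) (r *\<^sub>R v))) (at t)"
      by (rule has_derivative_compose[of "\<lambda>t. a + t *\<^sub>R v"])
        (use df[OF that] in \<open>auto intro!: derivative_eq_intros simp: frechet_derivative_works g_def\<close>)
    moreover have "frechet_derivative g (at (a + t *\<^sub>R v)) (r *\<^sub>R v)
        = frechet_derivative g (at (a + t *\<^sub>R v)) v * r" for r
      using linear_frechet_derivative[OF df[OF that]] by (simp add: linear_scale g_def)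
    ultimately show ?thesis
      by (simp add: has_field_derivative_def)
  qed
  let ?\<phi> = "\<lambda>s. f (x + h *\<^sub>R v + s *\<^sub>R u) - f (x + s *\<^sub>R u)"
  have "\<exists>s. 0 < s \<and> s < h \<and> ?\<phi> h - ?\<phi> 0 = (h - 0) * (g (x + h *\<^sub>R v + s *\<^sub>R u) - g (x + s *\<^sub>R u))"
  proof (rule MVT2[OF h(1)])
    fix s assume s: "0 \<le> s" "s \<le> h"
    show "(?\<phi> has_real_derivative g (x + h *\<^sub>R v + s *\<^sub>R u) - g (x + s *\<^sub>R u)) (at s)"
      by (intro DERIV_diff df') (use in_ball[OF s, of h] in_ball[OF s, of 0] h(1) in \<open>simp_all add: add_ac\<close>)
  qed
  then obtain s where s: "0 < s" "s < h"
    and eq1: "?\<phi> h - ?\<phi> 0 = h * (g (x + h *\<^sub>R v + s *\<^sub>R u) - g (x + s *\<^sub>R u))" by auto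
  have "\<exists>t. 0 < t \<and> t < h \<and> g (x + s *\<^sub>R u + h *\<^sub>R v) - g (x + s *\<^sub>R u + 0 *\<^sub>R v)
      = (h - 0) * frechet_derivative g (at (x + s *\<^sub>R u + t *\<^sub>R v)) v"
    by (rule MVT2[OF h(1)]) (use dg in_ball s in auto)
  then obtain t where t: "0 < t" "t < h" and eq2: "g (x + s *\<^sub>R u + h *\<^sub>R v) - g (x + s *\<^sub>R u)
      = h * frechet_derivative g (at (x + s *\<^sub>R u + t *\<^sub>R v)) v" by auto
  show ?thesis
  proof (rule that)
    show "x + s *\<^sub>R u + t *\<^sub>R v \<in> ball x d"
      using in_ball s t by simp
    show "f (x + h *\<^sub>R u + h *\<^sub>R v) - f (x + h *\<^sub>R u) - f (x + h *\<^sub>R v) + f x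
      = h\<^sup>2 * frechet_derivative (\<lambda>z. frechet_derivative f (at z) u) (at (x + s *\<^sub>R u + t *\<^sub>R v)) v"
      using eq1 eq2 by (simp add: g_def[symmetric] add_ac power2_eq_square)
  qed
qed

text \<open>The second difference is symmetric in \<open>u\<close> and \<open>v\<close>, so the two
  mixed derivatives agree at some pair of points arbitrarily near \<open>x\<close>. If they differed
  at \<open>x\<close>, continuity would keep them apart.\<close>

lemma frechet_derivative_commute:
  fixes f :: "'a::real_normed_vector \<Rightarrow> real"
  assumes "open S" "smooth_on S f" "x \<in> S"
  shows "frechet_derivative (\<lambda>y. frechet_derivative f (at y) u) (at x) v
    = frechet_derivative (\<lambda>y. frechet_derivative f (at y) v) (at x) u"
proof (rule ccontr)
  define F where "F = (\<lambda>u v y. frechet_derivative (\<lambda>y. frechet_derivative f (at y) u) (at y) v)"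
  assume "\<not> ?thesis"
  then have ne: "F u v x \<noteq> F v u x" by (simp add: F_def)
  \<comment> \<open>Half the gap: two values strictly within \<open>e\<close> of the two limits
    cannot coincide.\<close>
  define e where "e = \<bar>F u v x - F v u x\<bar> / 2"
  have e: "e > 0" using ne by (simp add: e_def)
  have sm: "smooth_on S (F u v)" for u v
    unfolding F_def using assms by (intro smooth_on_frechet_derivative)
  have "\<exists>d>0. ball x d \<subseteq> S \<and> (\<forall>y\<in>ball x d. \<bar>F u v y - F u v x\<bar> < e)" for u v
  proof -
    have "isCont (F u v) x"
      using smooth_on_imp_continuous_on[OF sm] assms(1,3) by (simp add: continuous_on_eq_continuous_at)
    then obtain d1 where "d1 > 0" "\<And>y. dist y x < d1 \<Longrightarrow> dist (F u v y) (F u v x) < e"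
      using e unfolding continuous_at_eps_delta by metis
    moreover obtain d2 where "d2 > 0" "ball x d2 \<subseteq> S"
      using assms(1,3) open_contains_ball by blast
    ultimately show ?thesis
      by (intro exI[of _ "min d1 d2"]) (auto simp: dist_real_def dist_commute subset_iff)
  qed
  then obtain d1 d2 where d: "d1 > 0" "ball x d1 \<subseteq> S" "\<And>y. y \<in> ball x d1 \<Longrightarrow> \<bar>F u v y - F u v x\<bar> < e"
     "d2 > 0" "ball x d2 \<subseteq> S" "\<And>y. y \<in> ball x d2 \<Longrightarrow> \<bar>F v u y - F v u x\<bar> < e"
    by metis
  \<comment> \<open>The summand 1 makes \<open>n\<close> positive even for zero vectors, and makes
    \<open>h * (norm u + norm v)\<close> strictly smaller than both radii.\<close>
  define n where "n = norm u + norm v + 1"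
  have n: "n > 0" by (simp add: n_def add_nonneg_pos)
  define h where "h = min d1 d2 / n"
  have h: "h > 0" using d n by (simp add: h_def)
  have "h * (norm u + norm v) < h * n" using h by (simp add: n_def)
  also have "\<dots> = min d1 d2" using n by (simp add: h_def)
  finally have hd: "h * (norm u + norm v) < d1" "h * (norm v + norm u) < d2" by (auto simp: add.commute)
  have dif: "f differentiable at y" "(\<lambda>z. frechet_derivative f (at z) w) differentiable at y"
    if "y \<in> S" for y w
    using smooth_on_imp_differentiable smooth_on_frechet_derivative assms(2) that by blast+
  obtain y where y: "y \<in> ball x d1" "f (x + h *\<^sub>R u + h *\<^sub>R v) - f (x + h *\<^sub>R u) - f (x + h *\<^sub>R v) + f x
      = h\<^sup>2 * F u v y"
    unfolding F_def by (rule second_difference_mvt[of x d1 f u h v]) (use d dif h hd in auto)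
  obtain z where z: "z \<in> ball x d2" "f (x + h *\<^sub>R v + h *\<^sub>R u) - f (x + h *\<^sub>R v) - f (x + h *\<^sub>R u) + f x
      = h\<^sup>2 * F v u z"
    unfolding F_def by (rule second_difference_mvt[of x d2 f v h u]) (use d dif h hd in auto)
  have "h\<^sup>2 * F u v y = h\<^sup>2 * F v u z"
    using y(2) z(2) by (simp only: add_ac)
  then have "F u v y = F v u z" using h by simp
  then show False using d(3)[OF y(1)] d(6)[OF z(1)] by (auto simp: e_def abs_if split: if_splits)
qed

section \<open>Vector fields as derivations\<close>

lemma vf_apply_cong:
  "open S \<Longrightarrow> x \<in> S \<Longrightarrow> (\<And>y. y \<in> S \<Longrightarrow> f y = g y) \<Longrightarrow> vf_apply X f x = vf_apply X g x"
  unfolding vf_apply_def by (metis frechet_derivative_cong_open)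

lemma vf_apply_eqI: "(f has_derivative D) (at x) \<Longrightarrow> vf_apply X f x = D (X x)"
  by (simp add: vf_apply_def frechet_derivative_eqI)

lemma vf_apply_const [simp]: "vf_apply X (\<lambda>y. c) x = 0"
  by (simp add: vf_apply_def)

lemma vf_apply_add:
  "f differentiable at x \<Longrightarrow> g differentiable at x
    \<Longrightarrow> vf_apply X (\<lambda>y. f y + g y) x = vf_apply X f x + vf_apply X g x"
  unfolding frechet_derivative_works
  by (rule vf_apply_eqI[OF has_derivative_add, THEN trans]) (auto simp: vf_apply_def)

lemma vf_apply_diff:
  "f differentiable at x \<Longrightarrow> g differentiable at x
    \<Longrightarrow> vf_apply X (\<lambda>y. f y - g y) x = vf_apply X f x - vf_apply X g x"
  unfolding frechet_derivative_works
  by (rule vf_apply_eqI[OF has_derivative_diff, THEN trans]) (auto simp: vf_apply_def)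

lemma vf_apply_mult:
  fixes f g :: "real ^ 'n::finite \<Rightarrow> real"
  shows "f differentiable at x \<Longrightarrow> g differentiable at x
    \<Longrightarrow> vf_apply X (\<lambda>y. f y * g y) x = vf_apply X f x * g x + f x * vf_apply X g x"
  unfolding frechet_derivative_works
  by (rule vf_apply_eqI[OF has_derivative_mult, THEN trans]) (auto simp: vf_apply_def)

lemma vf_apply_divide:
  fixes f g :: "real ^ 'n::finite \<Rightarrow> real"
  shows "f differentiable at x \<Longrightarrow> g differentiable at x \<Longrightarrow> g x \<noteq> 0
    \<Longrightarrow> vf_apply X (\<lambda>y. f y / g y) x = (vf_apply X f x * g x - f x * vf_apply X g x) / (g x * g x)"
  unfolding frechet_derivative_works
  by (rule vf_apply_eqI[OF has_derivative_divide', THEN trans]) (auto simp: vf_apply_def)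

lemma vf_apply_nth:
  assumes "Y differentiable at x"
  shows "vf_apply X Y x $ i = vf_apply X (\<lambda>y. Y y $ i) x"
  using vf_apply_eqI[OF bounded_linear.has_derivative[OF bounded_linear_vec_nth
      assms[unfolded frechet_derivative_works]], of X i]
  by (simp add: vf_apply_def)

lemma vf_apply_field_add:
  "f differentiable at x \<Longrightarrow> vf_apply (\<lambda>y. X y + X' y) f x = vf_apply X f x + vf_apply X' f x"
  by (simp add: vf_apply_def linear_add linear_frechet_derivative)

lemma vf_apply_field_scaleR:
  "f differentiable at x \<Longrightarrow> vf_apply (\<lambda>y. h y *\<^sub>R X y) f x = h x *\<^sub>R vf_apply X f x"
  by (simp add: vf_apply_def linear_scale linear_frechet_derivative)

lemma smooth_on_lie_bracket:
  "open S \<Longrightarrow> smooth_on S X \<Longrightarrow> smooth_on S Y \<Longrightarrow> smooth_on S (lie_bracket X Y)"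
  unfolding lie_bracket_def by (intro smooth_on_diff smooth_on_vf_apply)

text \<open>The product rule applied to Y(f) = sum of Y^i d_i f. Differentiating the coefficients
  gives the first term; the second is the Hessian of \<open>f\<close>, with the direction
  \<open>Y x\<close> frozen at \<open>x\<close>.\<close>

lemma vf_apply_vf_apply:
  fixes f :: "real ^ 'n::finite \<Rightarrow> real"
  assumes "open S" "smooth_on S Y" "smooth_on S f" "x \<in> S"
  shows "vf_apply X (vf_apply Y f) x
    = frechet_derivative f (at x) (vf_apply X Y x)
      + frechet_derivative (\<lambda>y. frechet_derivative f (at y) (Y x)) (at x) (X x)"
proof -
  define F where "F = (\<lambda>i y. frechet_derivative f (at y) (axis i 1))"
  have sF: "smooth_on S (F i)" for i
    unfolding F_def using assms by (intro smooth_on_frechet_derivative)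
  have expand: "frechet_derivative f (at y) v = (\<Sum>i\<in>UNIV. v $ i * F i y)" if "y \<in> S" for y v
    using frechet_derivative_vec_expand[OF smooth_on_imp_differentiable[OF assms(3) that], of v]
    by (simp add: F_def)
  have dF: "(F i has_derivative frechet_derivative (F i) (at x)) (at x)" for i
    using smooth_on_imp_differentiable[OF sF assms(4)] by (simp add: frechet_derivative_works)
  have dY: "(Y has_derivative frechet_derivative Y (at x)) (at x)"
    using smooth_on_imp_differentiable[OF assms(2,4)] by (simp add: frechet_derivative_works)
  have "vf_apply X (vf_apply Y f) x = vf_apply X (\<lambda>y. \<Sum>i\<in>UNIV. Y y $ i * F i y) x"
    by (rule vf_apply_cong[OF assms(1,4)]) (simp add: vf_apply_def expand)
  also have "\<dots> = (\<Sum>i\<in>UNIV. Y x $ i * frechet_derivative (F i) (at x) (X x)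
      + frechet_derivative Y (at x) (X x) $ i * F i x)"
    by (rule vf_apply_eqI)
      (intro has_derivative_sum has_derivative_mult dF bounded_linear.has_derivative[OF bounded_linear_vec_nth] dY)
  also have "\<dots> = (\<Sum>i\<in>UNIV. vf_apply X Y x $ i * F i x)
      + (\<Sum>i\<in>UNIV. Y x $ i * frechet_derivative (F i) (at x) (X x))"
    by (simp add: sum.distrib vf_apply_def)
  \<comment> \<open>The coefficients \<open>Y x $ i\<close> are now constants, so the sum can be put
    back under one derivative.\<close>
  also have "(\<Sum>i\<in>UNIV. Y x $ i * frechet_derivative (F i) (at x) (X x))
      = frechet_derivative (\<lambda>y. \<Sum>i\<in>UNIV. Y x $ i * F i y) (at x) (X x)"
    by (rule frechet_derivative_eqI[symmetric])
      (intro has_derivative_sum has_derivative_mult_right dF)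
  also have "\<dots> = frechet_derivative (\<lambda>y. frechet_derivative f (at y) (Y x)) (at x) (X x)"
    by (subst frechet_derivative_cong_open[OF assms(1,4)]) (auto simp: expand)
  finally show ?thesis
    using expand[OF assms(4)] by simp
qed

text \<open>The Hessian terms of X(Y(f)) and Y(X(f)) agree by symmetry, leaving the derivative of
  \<open>f\<close> along the bracket. Solved for X(Y(f)), it serves as a rewrite rule in
  \<open>curvature_conn\<close>.\<close>

lemma vf_apply_commutator:
  fixes f :: "real ^ 'n::finite \<Rightarrow> real"
  assumes "open S" "smooth_on S X" "smooth_on S Y" "smooth_on S f" "x \<in> S"
  shows "vf_apply X (vf_apply Y f) x = vf_apply Y (vf_apply X f) x + vf_apply (lie_bracket X Y) f x"
proof -
  have "linear (frechet_derivative f (at x))"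
    by (intro linear_frechet_derivative smooth_on_imp_differentiable[OF assms(4,5)])
  moreover have "vf_apply (lie_bracket X Y) f x = frechet_derivative f (at x) (vf_apply X Y x - vf_apply Y X x)"
    by (simp only: vf_apply_def lie_bracket_def)
  ultimately show ?thesis
    using vf_apply_vf_apply[OF assms(1,3,4,5), of X] vf_apply_vf_apply[OF assms(1,2,4,5), of Y]
      frechet_derivative_commute[OF assms(1,4,5), of "X x" "Y x"]
    by (simp only: linear_diff)
qed

section \<open>The Levi-Civita connection\<close>

lemma levi_civita_torsion_free:
  assumes "is_levi_civita S g nabla" "smooth_on S X" "smooth_on S Y" "x \<in> S"
  shows "nabla X Y x - nabla Y X x = lie_bracket X Y x"
  using assms by (simp add: is_levi_civita_def)

lemma levi_civita_metric_compatible: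
  assumes "is_levi_civita S g nabla" "smooth_on S X" "smooth_on S Y" "smooth_on S Z" "x \<in> S"
  shows "vf_apply X (\<lambda>y. g y (Y y) (Z y)) x = g x (nabla X Y x) (Z x) + g x (Y x) (nabla X Z x)"
  using assms by (simp add: is_levi_civita_def)

text \<open>The tensor \<open>T(X,Y,Z) = g(\<nabla>\<^sub>X Y - \<nabla>'\<^sub>X Y, Z)\<close> is symmetric in its first two and
  antisymmetric in its last two arguments, hence zero.\<close>
lemma levi_civita_unique:
  assumes g: "riemannian_metric S g"
    and L: "is_levi_civita S g nabla" "is_levi_civita S g nabla'"
    and X: "smooth_on S X" and Y: "smooth_on S Y" and x: "x \<in> S"
  shows "nabla X Y x = nabla' X Y x"
proof -
  define D where "D = (\<lambda>X Y. nabla X Y x - nabla' X Y x)"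
  have bil: "bilinear (g x)" and sym: "g x u v = g x v u"
    and pos: "v \<noteq> 0 \<Longrightarrow> 0 < g x v v" for u v
    using g x unfolding riemannian_metric_def by blast+
  have D_sym: "D X Y = D Y X" if "smooth_on S X" "smooth_on S Y" for X Y
  proof -
    have "D X Y - D Y X = (nabla X Y x - nabla Y X x) - (nabla' X Y x - nabla' Y X x)"
      by (simp add: D_def)
    also have "\<dots> = 0"
      using levi_civita_torsion_free[OF L(1) that x] levi_civita_torsion_free[OF L(2) that x] by simp
    finally show ?thesis by simp
  qed
  have D_anti: "g x (D X Y) (Z x) = - g x (D X Z) (Y x)"
    if "smooth_on S X" "smooth_on S Y" "smooth_on S Z" for X Y Z
  proof -
    have "g x (nabla X Y x) (Z x) + g x (Y x) (nabla X Z x)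
        = g x (nabla' X Y x) (Z x) + g x (Y x) (nabla' X Z x)"
      using levi_civita_metric_compatible[OF L(1) that x] levi_civita_metric_compatible[OF L(2) that x] by simp
    then show ?thesis
      using sym[of "Y x" "nabla X Z x"] sym[of "Y x" "nabla' X Z x"]
      unfolding D_def bilinear_lsub[OF bil] by linarith
  qed
  \<comment> \<open>The constant field extending the vector \<open>D X Y\<close> is smooth and turns
    \<open>g x (D X Y) (Z x)\<close> into a squared norm.\<close>
  define Z where "Z = (\<lambda>_::real ^ 'a. D X Y)"
  have Z: "smooth_on S Z" by (simp add: Z_def smooth_on_const)
  have "g x (D X Y) (Z x) = - g x (D X Z) (Y x)" by (rule D_anti) fact+
  also have "\<dots> = - g x (D Z X) (Y x)" using D_sym X Z by simp
  also have "\<dots> = g x (D Z Y) (X x)" using D_anti[of Z X Y] X Y Z by simp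
  also have "\<dots> = g x (D Y Z) (X x)" using D_sym Y Z by simp
  also have "\<dots> = - g x (D Y X) (Z x)" using D_anti[of Y Z X] X Y Z by simp
  also have "\<dots> = - g x (D X Y) (Z x)" using D_sym X Y by simp
  finally have "g x (D X Y) (D X Y) = 0" by (simp add: Z_def)
  with pos[of "D X Y"] have "D X Y = 0" by (cases "D X Y = 0") auto
  then show ?thesis by (simp add: D_def)
qed

section \<open>Functions of the third coordinate\<close>

text \<open>With \<open>X x\<close> frozen, symmetry of second derivatives moves \<open>X\<close>
  inside: X(f') is the x^3-derivative of X^3 f'. The conclusion has the same shape as the hypothesis
  on \<open>f\<close>, now for f'.\<close>

lemma vf_apply_d3:
  assumes "open S" "smooth_on S f" "x \<in> S"
    and f: "\<And>x X. x \<in> S \<Longrightarrow> vf_apply X f x = X x $ 3 * d3 f x"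
  shows "vf_apply X (d3 f) x = X x $ 3 * d3 (d3 f) x"
proof -
  have smooth: "smooth_on S (d3 f)"
    unfolding d3_def coord_vf_def by (intro smooth_on_vf_apply assms smooth_on_const)
  have *: "frechet_derivative f (at y) v = v $ 3 * d3 f y" if "y \<in> S" for y v
    using f[OF that, of "\<lambda>_. v"] by (simp add: vf_apply_def)
  have "vf_apply X (d3 f) x = frechet_derivative (\<lambda>y. frechet_derivative f (at y) (axis 3 1)) (at x) (X x)"
    by (simp add: vf_apply_def[abs_def] d3_def[abs_def] coord_vf_def)
  also have "\<dots> = frechet_derivative (\<lambda>y. frechet_derivative f (at y) (X x)) (at x) (axis 3 1)"
    by (rule frechet_derivative_commute[OF assms(1-3)])
  also have "\<dots> = frechet_derivative (\<lambda>y. X x $ 3 * d3 f y) (at x) (axis 3 1)"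
    by (subst frechet_derivative_cong_open[OF assms(1,3)]) (auto simp: *)
  also have "\<dots> = X x $ 3 * frechet_derivative (d3 f) (at x) (axis 3 1)"
    using smooth_on_imp_differentiable[OF smooth assms(3)]
    by (intro frechet_derivative_eqI has_derivative_mult_right) (simp add: frechet_derivative_works)
  finally show ?thesis
    by (simp add: d3_def[of "d3 f"] vf_apply_def coord_vf_def)
qed

text \<open>Along a line whose direction has third component 0 the function is locally constant, so
  its derivative kills such directions; only the third component of \<open>X x\<close>
  survives.\<close>

lemma vf_apply_depends_only_on_x3:
  assumes "open S" "smooth_on S f" "depends_only_on_x3 S f" "x \<in> S"
  shows "vf_apply X f x = X x $ 3 * d3 f x"
proof -
  let ?D = "frechet_derivative f (at x)"
  have D: "(f has_derivative ?D) (at x)"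
    using smooth_on_imp_differentiable[OF assms(2,4)] by (simp add: frechet_derivative_works)
  then have lin: "linear ?D" by (rule has_derivative_linear)
  have zero: "?D v = 0" if v: "v $ 3 = 0" for v
  proof -
    have "((\<lambda>t. x + t *\<^sub>R v) has_derivative (\<lambda>t. t *\<^sub>R v)) (at (0::real))"
      by (auto intro!: derivative_eq_intros)
    then have "((\<lambda>t. f (x + t *\<^sub>R v)) has_derivative (\<lambda>t. ?D (t *\<^sub>R v))) (at 0)"
      using has_derivative_compose[of "\<lambda>t. x + t *\<^sub>R v" "\<lambda>t. t *\<^sub>R v" "0::real" UNIV f ?D] D
      by simp
    moreover have "((\<lambda>t. f (x + t *\<^sub>R v)) has_derivative (\<lambda>t. 0)) (at 0)"
    proof (rule has_derivative_transform_within_open)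
      show "((\<lambda>t::real. f x) has_derivative (\<lambda>t. 0)) (at 0)" by simp
      \<comment> \<open>The hypothesis on \<open>f\<close> compares points of \<open>S\<close> only;
        this preimage is the set of parameters for which the line stays in \<open>S\<close>.\<close>
      show "open ((\<lambda>t. x + t *\<^sub>R v) -` S)"
        by (intro open_vimage assms(1) continuous_intros)
      show "f x = f (x + t *\<^sub>R v)" if "t \<in> (\<lambda>t. x + t *\<^sub>R v) -` S" for t
        using assms(3)[unfolded depends_only_on_x3_def, rule_format, OF assms(4), of "x + t *\<^sub>R v"] v that
        by simp
      show "0 \<in> (\<lambda>t. x + t *\<^sub>R v) -` S" using assms(4) by simp
    qed
    ultimately have "(\<lambda>t. ?D (t *\<^sub>R v)) = (\<lambda>t. 0)" by (rule has_derivative_unique)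
    from fun_cong[OF this, of 1] show ?thesis by simp
  qed
  have "?D (X x) = ?D (X x $ 3 *\<^sub>R axis 3 1) + ?D (X x - X x $ 3 *\<^sub>R axis 3 1)"
    using linear_add[OF lin, of "X x $ 3 *\<^sub>R axis 3 1" "X x - X x $ 3 *\<^sub>R axis 3 1"] by simp
  also have "?D (X x - X x $ 3 *\<^sub>R axis 3 1) = 0"
    by (rule zero) (simp add: axis_def)
  finally show ?thesis
    by (simp add: linear_scale[OF lin] vf_apply_def[abs_def] d3_def coord_vf_def)
qed

section \<open>The metric of a frame depending on one coordinate\<close>

locale x3_frame =
  fixes S :: "(real ^ 3) set" and f1 f2 :: "real ^ 3 \<Rightarrow> real"
  assumes open_S: "open S"
    and smooth_f: "smooth_on S f1" "smooth_on S f2"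
    and nonzero_f: "x \<in> S \<Longrightarrow> f1 x \<noteq> 0" "x \<in> S \<Longrightarrow> f2 x \<noteq> 0"
    and depends_f: "depends_only_on_x3 S f1" "depends_only_on_x3 S f2"
begin

section \<open>Logarithmic derivatives and metric coefficients\<close>

definition "p x = d3 f1 x / f1 x"
definition "q x = d3 f2 x / f2 x"
definition "a x = 1 / (f1 x)\<^sup>2"
definition "b x = 1 / (f2 x)\<^sup>2"

lemma smooth_d3: "smooth_on S f \<Longrightarrow> smooth_on S (d3 f)"
  unfolding d3_def coord_vf_def using open_S by (intro smooth_on_vf_apply smooth_on_const)

lemma smooth_coefficients: "smooth_on S p" "smooth_on S q" "smooth_on S a" "smooth_on S b"
  unfolding p_def[abs_def] q_def[abs_def] a_def[abs_def] b_def[abs_def]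
  by (intro smooth_on_divide smooth_on_power smooth_on_const smooth_d3 open_S smooth_f; simp add: nonzero_f)+

lemma vf_apply_f:
  "x \<in> S \<Longrightarrow> vf_apply X f1 x = X x $ 3 * d3 f1 x"
  "x \<in> S \<Longrightarrow> vf_apply X f2 x = X x $ 3 * d3 f2 x"
  using vf_apply_depends_only_on_x3 open_S smooth_f depends_f by blast+

lemma vf_apply_d3_f:
  "x \<in> S \<Longrightarrow> vf_apply X (d3 f1) x = X x $ 3 * d3 (d3 f1) x"
  "x \<in> S \<Longrightarrow> vf_apply X (d3 f2) x = X x $ 3 * d3 (d3 f2) x"
  using vf_apply_d3[OF open_S] smooth_f vf_apply_f by blast+

lemma vf_apply_p_q:
  assumes "x \<in> S"
  shows "vf_apply X p x = X x $ 3 * (d3 (d3 f1) x / f1 x - (p x)\<^sup>2)"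
    "vf_apply X q x = X x $ 3 * (d3 (d3 f2) x / f2 x - (q x)\<^sup>2)"
  unfolding p_def[abs_def] q_def[abs_def]
  using assms nonzero_f[OF assms] smooth_on_imp_differentiable[OF smooth_f(1) assms] smooth_on_imp_differentiable[OF smooth_f(2) assms]
    smooth_on_imp_differentiable[OF smooth_d3[OF smooth_f(1)] assms] smooth_on_imp_differentiable[OF smooth_d3[OF smooth_f(2)] assms]
  by (simp_all add: vf_apply_divide vf_apply_f vf_apply_d3_f field_simps power2_eq_square)

lemma d3_p_q:
  assumes "x \<in> S"
  shows "d3 p x = d3 (d3 f1) x / f1 x - (p x)\<^sup>2" "d3 q x = d3 (d3 f2) x / f2 x - (q x)\<^sup>2"
  unfolding d3_def[of p] d3_def[of q]
  using vf_apply_p_q[OF assms, of "coord_vf 3"] by (simp_all add: coord_vf_def axis_def)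

text \<open>Since a = f1^(-2), its logarithmic derivative is -2p, and likewise -2q for b.
  Differentiating a polynomial in p, q, a, b thus gives a polynomial in these together with p' and
  q'.\<close>

lemma vf_apply_coefficients:
  assumes "x \<in> S"
  shows "vf_apply X p x = X x $ 3 * d3 p x" "vf_apply X q x = X x $ 3 * d3 q x"
    "vf_apply X a x = - 2 * X x $ 3 * p x * a x" "vf_apply X b x = - 2 * X x $ 3 * q x * b x"
proof -
  show "vf_apply X p x = X x $ 3 * d3 p x" "vf_apply X q x = X x $ 3 * d3 q x"
    using assms by (simp_all add: vf_apply_p_q d3_p_q)
  have *: "(\<lambda>y. f y * f y) differentiable at x" if "smooth_on S f" for f :: "real ^ 3 \<Rightarrow> real"
    by (intro smooth_on_imp_differentiable[of S] smooth_on_mult open_S that assms)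
  show "vf_apply X a x = - 2 * X x $ 3 * p x * a x" "vf_apply X b x = - 2 * X x $ 3 * q x * b x"
    unfolding a_def[abs_def] b_def[abs_def] p_def q_def power2_eq_square
    using assms nonzero_f[OF assms] smooth_on_imp_differentiable[OF smooth_f(1) assms] smooth_on_imp_differentiable[OF smooth_f(2) assms]
      *[OF smooth_f(1)] *[OF smooth_f(2)]
    by (simp_all add: vf_apply_divide vf_apply_mult vf_apply_f field_simps)
qed

text \<open>The added vector collects the nonzero Christoffel symbols \<open>\<Gamma>\<^sup>1\<^sub>1\<^sub>3 = -p\<close>,
  \<open>\<Gamma>\<^sup>2\<^sub>2\<^sub>3 = -q\<close>, \<open>\<Gamma>\<^sup>3\<^sub>1\<^sub>1 = pa\<close>, \<open>\<Gamma>\<^sup>3\<^sub>2\<^sub>2 = qb\<close>.\<close>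
definition conn :: "3 conn" where
  "conn X Y x = vf_apply X Y x + vector
     [- p x * (X x $ 1 * Y x $ 3 + X x $ 3 * Y x $ 1),
      - q x * (X x $ 2 * Y x $ 3 + X x $ 3 * Y x $ 2),
      p x * a x * (X x $ 1 * Y x $ 1) + q x * b x * (X x $ 2 * Y x $ 2)]"

abbreviation "g \<equiv> metric3 f1 f2"

lemma metric_eq:
  "g x u v = a x * (u $ 1 * v $ 1) + b x * (u $ 2 * v $ 2) + u $ 3 * v $ 3"
  by (simp add: metric3_def tensor_prod_def dx_def a_def b_def)

lemma coefficients_pos: "x \<in> S \<Longrightarrow> 0 < a x" "x \<in> S \<Longrightarrow> 0 < b x"
  using nonzero_f by (simp_all add: a_def b_def)

section \<open>The metric, its frame and its connection\<close>

lemma riemannian_metric3: "riemannian_metric S g"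
proof -
  have "bilinear (g x)" for x
    unfolding bilinear_def by (auto intro!: linearI simp: metric_eq algebra_simps)
  moreover have "0 < g x v v" if "x \<in> S" "v \<noteq> 0" for x v
  proof -
    have nn: "0 \<le> a x * (v $ 1 * v $ 1)" "0 \<le> b x * (v $ 2 * v $ 2)" "0 \<le> v $ 3 * v $ 3"
      using coefficients_pos[OF that(1)] by simp_all
    have "v $ 1 \<noteq> 0 \<or> v $ 2 \<noteq> 0 \<or> v $ 3 \<noteq> 0"
      using that(2) by (auto simp: vec_eq_iff forall_3)
    then have "0 < a x * (v $ 1 * v $ 1) \<or> 0 < b x * (v $ 2 * v $ 2) \<or> 0 < v $ 3 * v $ 3"
      using coefficients_pos[OF that(1)] by (simp add: zero_less_mult_iff linorder_neq_iff) blast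
    then show ?thesis unfolding metric_eq using nn by linarith
  qed
  moreover have "smooth_on S (\<lambda>x. g x u v)" for u v
    unfolding metric_eq by (intro smooth_on_add smooth_on_mult smooth_on_const open_S smooth_coefficients)
  moreover have "g x u v = g x v u" for x u v
    by (simp add: metric_eq mult.commute)
  ultimately show ?thesis
    unfolding riemannian_metric_def by blast
qed

lemma orthonormal_frame3: "orthonormal_frame S g (frame3 f1 f2)"
proof -
  have "smooth_on S (frame3 f1 f2 i)" for i
    unfolding frame3_def coord_vf_def
    by (cases "i = 1"; cases "i = 2"; simp add: smooth_on_const smooth_on_scaleR open_S smooth_f)
  moreover have "\<forall>i j. g x (frame3 f1 f2 i x) (frame3 f1 f2 j x) = (if i = j then 1 else 0)" if "x \<in> S" for x
    using nonzero_f[OF that]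
    by (simp add: forall_3 frame3_def metric_eq coord_vf_def axis_def a_def b_def power2_eq_square)
  ultimately show ?thesis
    unfolding orthonormal_frame_def by blast
qed

text \<open>Reduces identities between vector fields to scalar polynomial identities in which the
  derivatives of components are atoms.\<close>

lemma conn_nth:
  assumes "smooth_on S Y" "x \<in> S"
  shows "conn X Y x $ 1 = vf_apply X (\<lambda>y. Y y $ 1) x - p x * (X x $ 1 * Y x $ 3 + X x $ 3 * Y x $ 1)"
    "conn X Y x $ 2 = vf_apply X (\<lambda>y. Y y $ 2) x - q x * (X x $ 2 * Y x $ 3 + X x $ 3 * Y x $ 2)"
    "conn X Y x $ 3 = vf_apply X (\<lambda>y. Y y $ 3) x
       + p x * a x * (X x $ 1 * Y x $ 1) + q x * b x * (X x $ 2 * Y x $ 2)"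
  using smooth_on_imp_differentiable[OF assms] by (simp_all add: conn_def vf_apply_nth)

lemma conn_cong:
  assumes "\<And>y. y \<in> S \<Longrightarrow> Y y = Y' y" "x \<in> S"
  shows "conn X Y x = conn X Y' x"
  using vf_apply_cong[OF open_S assms(2), of Y Y' X] assms by (simp add: conn_def)

lemmas smooth_intros = open_S smooth_coefficients smooth_on_vec_nth smooth_on_const smooth_on_add
  smooth_on_diff smooth_on_mult smooth_on_vf_apply smooth_on_lie_bracket

lemma smooth_conn:
  assumes "smooth_on S X" "smooth_on S Y"
  shows "smooth_on S (conn X Y)"
proof (rule smooth_on_vec[OF open_S])
  fix i :: 3
  have "\<forall>i. smooth_on S (\<lambda>x. conn X Y x $ i)"
    unfolding forall_3
  proof (intro conjI)
    show "smooth_on S (\<lambda>x. conn X Y x $ 1)"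
      by (rule smooth_on_cong[OF open_S conn_nth(1)[OF assms(2), symmetric]]) (assumption | intro smooth_intros assms)+
    show "smooth_on S (\<lambda>x. conn X Y x $ 2)"
      by (rule smooth_on_cong[OF open_S conn_nth(2)[OF assms(2), symmetric]]) (assumption | intro smooth_intros assms)+
    show "smooth_on S (\<lambda>x. conn X Y x $ 3)"
      by (rule smooth_on_cong[OF open_S conn_nth(3)[OF assms(2), symmetric]]) (assumption | intro smooth_intros assms)+
  qed
  then show "smooth_on S (\<lambda>x. conn X Y x $ i)" by blast
qed

lemma affine_connection_conn: "affine_connection S conn"
  unfolding affine_connection_def
proof (intro conjI allI impI ballI)
  fix f :: "real ^ 3 \<Rightarrow> real" and X X' Y Y' :: "3 vfield" and x
  assume "x \<in> S"
  note d = smooth_on_imp_differentiable[OF _ \<open>x \<in> S\<close>]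
  note vec_d = d[OF smooth_on_vec_nth[OF open_S]]
  { assume "smooth_on S X" "smooth_on S X'" "smooth_on S Y"
    then show "conn (\<lambda>y. X y + X' y) Y x = conn X Y x + conn X' Y x"
      using \<open>x \<in> S\<close>
      by (simp add: vec_eq_iff forall_3 conn_nth vf_apply_field_add vec_d algebra_simps) }
  { assume "smooth_on S f" "smooth_on S X" "smooth_on S Y"
    then show "conn (\<lambda>y. f y *\<^sub>R X y) Y x = f x *\<^sub>R conn X Y x"
      using \<open>x \<in> S\<close>
      by (simp add: vec_eq_iff forall_3 conn_nth vf_apply_field_scaleR vec_d algebra_simps) }
  { assume "smooth_on S X" "smooth_on S Y" "smooth_on S Y'"
    then show "conn X (\<lambda>y. Y y + Y' y) x = conn X Y x + conn X Y' x"
      using \<open>x \<in> S\<close>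
      by (simp add: vec_eq_iff forall_3 conn_nth smooth_on_add[OF open_S] vf_apply_add vec_d algebra_simps) }
  { assume "smooth_on S f" "smooth_on S X" "smooth_on S Y"
    then show "conn X (\<lambda>y. f y *\<^sub>R Y y) x = vf_apply X f x *\<^sub>R Y x + f x *\<^sub>R conn X Y x"
      using \<open>x \<in> S\<close>
      by (simp add: vec_eq_iff forall_3 conn_nth smooth_on_scaleR[OF open_S] vf_apply_mult d vec_d algebra_simps) }
qed (rule smooth_conn)

lemma lie_bracket_nth:
  assumes "smooth_on S X" "smooth_on S Y" "x \<in> S"
  shows "lie_bracket X Y x $ i = vf_apply X (\<lambda>y. Y y $ i) x - vf_apply Y (\<lambda>y. X y $ i) x"
  using smooth_on_imp_differentiable[OF assms(1,3)] smooth_on_imp_differentiable[OF assms(2,3)]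
  by (simp add: lie_bracket_def vf_apply_nth)

text \<open>The product rule, with the derivatives of a and b replaced by -2pa and -2qb times X^3.
  It serves both metric compatibility and the Lie derivative.\<close>

lemma vf_apply_metric:
  assumes "smooth_on S Y" "smooth_on S Z" "x \<in> S"
  shows "vf_apply X (\<lambda>y. g y (Y y) (Z y)) x
    = a x * (vf_apply X (\<lambda>y. Y y $ 1) x * Z x $ 1 + Y x $ 1 * vf_apply X (\<lambda>y. Z y $ 1) x
          - 2 * X x $ 3 * p x * (Y x $ 1 * Z x $ 1))
      + b x * (vf_apply X (\<lambda>y. Y y $ 2) x * Z x $ 2 + Y x $ 2 * vf_apply X (\<lambda>y. Z y $ 2) x
          - 2 * X x $ 3 * q x * (Y x $ 2 * Z x $ 2))
      + vf_apply X (\<lambda>y. Y y $ 3) x * Z x $ 3 + Y x $ 3 * vf_apply X (\<lambda>y. Z y $ 3) x"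
proof -
  note d = smooth_on_imp_differentiable[OF _ assms(3)]
  show ?thesis
    unfolding metric_eq
    using assms
    by (simp add: vf_apply_add vf_apply_mult d smooth_intros vf_apply_coefficients algebra_simps)
qed

text \<open>The Christoffel part is symmetric in X and Y, so torsion vanishes. In the metric
  identity its terms with X^1 or X^2 cancel in pairs, and those with X^3 give the derivatives of a
  and b.\<close>

lemma is_levi_civita_conn: "is_levi_civita S g conn"
  unfolding is_levi_civita_def
proof (intro conjI allI impI ballI affine_connection_conn)
  fix X Y Z :: "3 vfield" and x
  assume x: "x \<in> S"
  { assume "smooth_on S X" "smooth_on S Y"
    then show "conn X Y x - conn Y X x = lie_bracket X Y x"
      using x by (simp add: vec_eq_iff forall_3 conn_nth lie_bracket_nth algebra_simps) }
  { assume "smooth_on S X" "smooth_on S Y" "smooth_on S Z"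
    then show "vf_apply X (\<lambda>y. g y (Y y) (Z y)) x = g x (conn X Y x) (Z x) + g x (Y x) (conn X Z x)"
      using x by (simp add: vf_apply_metric) (simp add: metric_eq conn_nth algebra_simps) }
qed

text \<open>\<open>conn\<close> witnesses existence, so the choice in \<open>levi_civita\<close> is
  a genuine Levi-Civita connection; uniqueness then identifies the two.\<close>

lemma levi_civita_eq_conn:
  assumes "smooth_on S X" "smooth_on S Y" "x \<in> S"
  shows "levi_civita S g X Y x = conn X Y x"
proof (rule levi_civita_unique[OF riemannian_metric3 _ is_levi_civita_conn assms])
  show "is_levi_civita S g (levi_civita S g)"
    unfolding levi_civita_def by (rule someI[of "is_levi_civita S g", OF is_levi_civita_conn])
qed

section \<open>Curvature, Ricci tensor and Lie derivative\<close>

text \<open>Curvature nests the connection, and the inner field is known only on \<open>S\<close>.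
  It is first seen to be smooth there, which lets the outer connection be replaced, and then
  exchanged by \<open>conn_cong\<close>.\<close>

lemma curvature_levi_civita:
  assumes "smooth_on S X" "smooth_on S Y" "smooth_on S Z" "x \<in> S"
  shows "curvature (levi_civita S g) X Y Z x = curvature conn X Y Z x"
proof -
  have nested: "levi_civita S g X (levi_civita S g Y Z) x = conn X (conn Y Z) x"
    if X: "smooth_on S X" and Y: "smooth_on S Y" for X Y
  proof -
    have eq: "levi_civita S g Y Z y = conn Y Z y" if "y \<in> S" for y
      by (rule levi_civita_eq_conn[OF Y assms(3) that])
    have "smooth_on S (levi_civita S g Y Z)"
      by (rule smooth_on_cong[OF open_S eq[symmetric] smooth_conn[OF Y assms(3)]])
    then have "levi_civita S g X (levi_civita S g Y Z) x = conn X (levi_civita S g Y Z) x"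
      by (rule levi_civita_eq_conn[OF X _ assms(4)])
    also have "\<dots> = conn X (conn Y Z) x"
      by (rule conn_cong[OF eq assms(4)])
    finally show ?thesis .
  qed
  show ?thesis
    unfolding curvature_def nested[OF assms(1,2)] nested[OF assms(2,1)]
      levi_civita_eq_conn[OF smooth_on_lie_bracket[OF open_S assms(1,2)] assms(3,4)] ..
qed

text \<open>Differentiates the component formulas of \<open>conn\<close>. The factors p' - 2p^2 and
  q' - 2q^2 come from the derivatives of pa and qb.\<close>

lemma vf_apply_conn_nth:
  assumes "smooth_on S Y" "smooth_on S Z" "x \<in> S"
  shows "vf_apply X (\<lambda>y. conn Y Z y $ 1) x = vf_apply X (vf_apply Y (\<lambda>z. Z z $ 1)) x
      - X x $ 3 * d3 p x * (Y x $ 1 * Z x $ 3 + Y x $ 3 * Z x $ 1)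
      - p x * (vf_apply X (\<lambda>y. Y y $ 1) x * Z x $ 3 + Y x $ 1 * vf_apply X (\<lambda>y. Z y $ 3) x
        + vf_apply X (\<lambda>y. Y y $ 3) x * Z x $ 1 + Y x $ 3 * vf_apply X (\<lambda>y. Z y $ 1) x)" (is ?t1)
    "vf_apply X (\<lambda>y. conn Y Z y $ 2) x = vf_apply X (vf_apply Y (\<lambda>z. Z z $ 2)) x
      - X x $ 3 * d3 q x * (Y x $ 2 * Z x $ 3 + Y x $ 3 * Z x $ 2)
      - q x * (vf_apply X (\<lambda>y. Y y $ 2) x * Z x $ 3 + Y x $ 2 * vf_apply X (\<lambda>y. Z y $ 3) x
        + vf_apply X (\<lambda>y. Y y $ 3) x * Z x $ 2 + Y x $ 3 * vf_apply X (\<lambda>y. Z y $ 2) x)" (is ?t2)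
    "vf_apply X (\<lambda>y. conn Y Z y $ 3) x = vf_apply X (vf_apply Y (\<lambda>z. Z z $ 3)) x
      + X x $ 3 * (d3 p x - 2 * (p x)\<^sup>2) * a x * (Y x $ 1 * Z x $ 1)
      + p x * a x * (vf_apply X (\<lambda>y. Y y $ 1) x * Z x $ 1 + Y x $ 1 * vf_apply X (\<lambda>y. Z y $ 1) x)
      + X x $ 3 * (d3 q x - 2 * (q x)\<^sup>2) * b x * (Y x $ 2 * Z x $ 2)
      + q x * b x * (vf_apply X (\<lambda>y. Y y $ 2) x * Z x $ 2 + Y x $ 2 * vf_apply X (\<lambda>y. Z y $ 2) x)" (is ?t3)
proof -
  note d = smooth_on_imp_differentiable[OF _ assms(3)]
  have c: "vf_apply X (\<lambda>y. conn Y Z y $ i) x = vf_apply X h x"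
    if "\<And>y. y \<in> S \<Longrightarrow> conn Y Z y $ i = h y" for i h
    using vf_apply_cong[OF open_S assms(3) that] .
  note rules = vf_apply_add vf_apply_diff vf_apply_mult d smooth_intros vf_apply_coefficients
  show ?t1
    by (rule trans[OF c], erule conn_nth(1)[OF assms(2)]) (simp add: assms rules algebra_simps)
  show ?t2
    by (rule trans[OF c], erule conn_nth(2)[OF assms(2)]) (simp add: assms rules algebra_simps)
  show ?t3
    by (rule trans[OF c], erule conn_nth(3)[OF assms(2)]) (simp add: assms rules algebra_simps power2_eq_square)
qed

text \<open>After the commutator rule and the bracket formula all derivatives of X, Y, Z cancel, as
  they must for a tensor. The sectional curvatures of the coordinate planes 13, 23, 12 are p' - p^2,
  q' - q^2, -pq.\<close>

lemma curvature_conn: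
  assumes X: "smooth_on S X" and Y: "smooth_on S Y" and Z: "smooth_on S Z" and x: "x \<in> S"
  shows "curvature conn X Y Z x $ 1
      = ((p x)\<^sup>2 - d3 p x) * Z x $ 3 * (X x $ 3 * Y x $ 1 - X x $ 1 * Y x $ 3)
        - p x * q x * b x * Z x $ 2 * (X x $ 1 * Y x $ 2 - X x $ 2 * Y x $ 1)" (is ?t1)
    "curvature conn X Y Z x $ 2
      = ((q x)\<^sup>2 - d3 q x) * Z x $ 3 * (X x $ 3 * Y x $ 2 - X x $ 2 * Y x $ 3)
        - p x * q x * a x * Z x $ 1 * (X x $ 2 * Y x $ 1 - X x $ 1 * Y x $ 2)" (is ?t2)
    "curvature conn X Y Z x $ 3
      = (d3 p x - (p x)\<^sup>2) * a x * Z x $ 1 * (X x $ 3 * Y x $ 1 - X x $ 1 * Y x $ 3)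
        + (d3 q x - (q x)\<^sup>2) * b x * Z x $ 2 * (X x $ 3 * Y x $ 2 - X x $ 2 * Y x $ 3)" (is ?t3)
proof -
  note YZ = smooth_conn[OF Y Z] and XZ = smooth_conn[OF X Z]
    and L = smooth_on_lie_bracket[OF open_S X Y]
  note conns = conn_nth[OF YZ x, of X] conn_nth[OF XZ x, of Y] conn_nth[OF Z x, of X] conn_nth[OF Z x, of Y]
    conn_nth[OF Z x, of "lie_bracket X Y"] vf_apply_conn_nth[OF Y Z x, of X] vf_apply_conn_nth[OF X Z x, of Y]
    lie_bracket_nth[OF X Y x]
    vf_apply_commutator[OF open_S X Y smooth_on_vec_nth[OF open_S Z] x]
  show ?t1 unfolding curvature_def vector_minus_component conns
    by (simp add: algebra_simps power2_eq_square)
  show ?t2 unfolding curvature_def vector_minus_component conns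
    by (simp add: algebra_simps power2_eq_square)
  show ?t3 unfolding curvature_def vector_minus_component conns
    by (simp add: algebra_simps power2_eq_square)
qed

lemma ricci_eq:
  assumes Y: "smooth_on S Y" and Z: "smooth_on S Z" and x: "x \<in> S"
  shows "ricci S g (frame3 f1 f2) Y Z x
    = (d3 p x - (p x)\<^sup>2 - p x * q x) * a x * (Y x $ 1 * Z x $ 1)
      + (d3 q x - (q x)\<^sup>2 - p x * q x) * b x * (Y x $ 2 * Z x $ 2)
      + (d3 p x - (p x)\<^sup>2 + d3 q x - (q x)\<^sup>2) * (Y x $ 3 * Z x $ 3)"
proof -
  have E: "smooth_on S (frame3 f1 f2 k)" for k
    using orthonormal_frame3 by (simp add: orthonormal_frame_def)
  \<comment> \<open>The frame fields have unit length. The traces below keep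
    \<open>a x * (f1 x * f1 x)\<close> and \<open>b x * (f2 x * f2 x)\<close> as factors so that
    this removes f1 and f2.\<close>
  have unit: "a x * (f1 x * f1 x) = 1" "b x * (f2 x * f2 x) = 1"
    using nonzero_f[OF x] by (simp_all add: a_def b_def power2_eq_square)
  let ?R = "\<lambda>k. curvature (levi_civita S g) (frame3 f1 f2 k) Y Z x"
  have R: "?R k = curvature conn (frame3 f1 f2 k) Y Z x" for k
    by (rule curvature_levi_civita[OF E Y Z x])
  have "g x (?R 1) (frame3 f1 f2 1 x)
      = a x * (f1 x * f1 x) * ((d3 p x - (p x)\<^sup>2) * (Y x $ 3 * Z x $ 3) - p x * q x * b x * (Y x $ 2 * Z x $ 2))"
    unfolding R metric_eq curvature_conn[OF E Y Z x]
    by (simp add: frame3_def coord_vf_def axis_def algebra_simps)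
  moreover have "g x (?R 2) (frame3 f1 f2 2 x)
      = b x * (f2 x * f2 x) * ((d3 q x - (q x)\<^sup>2) * (Y x $ 3 * Z x $ 3) - p x * q x * a x * (Y x $ 1 * Z x $ 1))"
    unfolding R metric_eq curvature_conn[OF E Y Z x]
    by (simp add: frame3_def coord_vf_def axis_def algebra_simps)
  moreover have "g x (?R 3) (frame3 f1 f2 3 x)
      = (d3 p x - (p x)\<^sup>2) * a x * (Y x $ 1 * Z x $ 1) + (d3 q x - (q x)\<^sup>2) * b x * (Y x $ 2 * Z x $ 2)"
    unfolding R metric_eq curvature_conn[OF E Y Z x]
    by (simp add: frame3_def coord_vf_def axis_def algebra_simps)
  ultimately show ?thesis
    unfolding ricci_def sum_3 unit by (simp add: algebra_simps)
qed

text \<open>\<open>coord_vf 3\<close> has constant components, so its bracket with Y just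
  differentiates the components of Y. These terms cancel against the product rule, leaving the
  x^3-derivatives of a and b.\<close>

lemma lie_derivative_eq:
  assumes Y: "smooth_on S Y" and Z: "smooth_on S Z" and x: "x \<in> S"
  shows "lie_derivative (coord_vf 3) g Y Z x
    = - 2 * p x * a x * (Y x $ 1 * Z x $ 1) - 2 * q x * b x * (Y x $ 2 * Z x $ 2)"
proof -
  have V: "smooth_on S (coord_vf 3)"
    unfolding coord_vf_def by (rule smooth_on_const)
  have [simp]: "vf_apply X (\<lambda>y. coord_vf 3 y $ i) x = 0" for X i
    by (simp add: coord_vf_def)
  show ?thesis
    unfolding lie_derivative_def vf_apply_metric[OF Y Z x]
    by (simp add: metric_eq lie_bracket_nth[OF V Y x] lie_bracket_nth[OF V Z x] algebra_simps)
      (simp add: coord_vf_def axis_def)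
qed

section \<open>The soliton equation\<close>

lemma soliton_iff:
  assumes "smooth_on S lam" "smooth_on S mu" "\<exists>x\<in>S. mu x \<noteq> 0"
  shows "almost_eta_ricci_soliton S g (frame3 f1 f2) (coord_vf 3) (dx 3) lam mu \<longleftrightarrow>
    (\<forall>x\<in>S. lam x = p x + p x * q x + (p x)\<^sup>2 - d3 p x
         \<and> lam x = q x + p x * q x + (q x)\<^sup>2 - d3 q x
         \<and> lam x + mu x = (p x)\<^sup>2 - d3 p x + (q x)\<^sup>2 - d3 q x)"
    (is "?L \<longleftrightarrow> ?R")
proof -
  \<comment> \<open>The left side of the soliton equation is diagonal with entries A a, B b and C in
    the coordinate fields.\<close>
  define A where "A = (\<lambda>x. lam x - p x - p x * q x - (p x)\<^sup>2 + d3 p x)"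
  define B where "B = (\<lambda>x. lam x - q x - p x * q x - (q x)\<^sup>2 + d3 q x)"
  define C where "C = (\<lambda>x. lam x + mu x + d3 p x - (p x)\<^sup>2 + d3 q x - (q x)\<^sup>2)"
  let ?lhs = "\<lambda>Y Z x. 1 / 2 * lie_derivative (coord_vf 3) g Y Z x + ricci S g (frame3 f1 f2) Y Z x
               + lam x * g x (Y x) (Z x) + mu x * tensor_prod (dx 3) (dx 3) x (Y x) (Z x)"
  have lhs: "?lhs Y Z x = A x * a x * (Y x $ 1 * Z x $ 1) + B x * b x * (Y x $ 2 * Z x $ 2) + C x * (Y x $ 3 * Z x $ 3)"
    if "smooth_on S Y" "smooth_on S Z" "x \<in> S" for Y Z x
    unfolding lie_derivative_eq[OF that] ricci_eq[OF that] metric_eq A_def B_def C_def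
    by (simp add: tensor_prod_def dx_def algebra_simps)
  have const: "smooth_on S (coord_vf i)" for i
    unfolding coord_vf_def by (rule smooth_on_const)
  have "smooth_form1 S (dx 3)"
    unfolding smooth_form1_def dx_def by (simp add: smooth_on_const linearI)
  then have "?L \<longleftrightarrow> (\<forall>Y Z. smooth_on S Y \<longrightarrow> smooth_on S Z \<longrightarrow> (\<forall>x\<in>S. ?lhs Y Z x = 0))"
    unfolding almost_eta_ricci_soliton_def
    using assms riemannian_metric3 orthonormal_frame3 const by blast
  also have "\<dots> \<longleftrightarrow> (\<forall>x\<in>S. A x = 0 \<and> B x = 0 \<and> C x = 0)"
  proof
    assume *: "\<forall>Y Z. smooth_on S Y \<longrightarrow> smooth_on S Z \<longrightarrow> (\<forall>x\<in>S. ?lhs Y Z x = 0)"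
    show "\<forall>x\<in>S. A x = 0 \<and> B x = 0 \<and> C x = 0"
    proof
      fix x assume x: "x \<in> S"
      \<comment> \<open>Testing on Y = Z = \<open>coord_vf i\<close> isolates the i-th diagonal
        entry; a and b are positive and can be cancelled.\<close>
      have "A x * a x * (coord_vf i x $ 1 * coord_vf i x $ 1) + B x * b x * (coord_vf i x $ 2 * coord_vf i x $ 2)
          + C x * (coord_vf i x $ 3 * coord_vf i x $ 3) = 0" for i
        using *[rule_format, OF const const x, of i i] lhs[OF const const x, of i i] by simp
      from this[of 1] this[of 2] this[of 3] show "A x = 0 \<and> B x = 0 \<and> C x = 0"
        using coefficients_pos[OF x] by (simp add: coord_vf_def axis_def)
    qed
  next
    assume *: "\<forall>x\<in>S. A x = 0 \<and> B x = 0 \<and> C x = 0"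
    show "\<forall>Y Z. smooth_on S Y \<longrightarrow> smooth_on S Z \<longrightarrow> (\<forall>x\<in>S. ?lhs Y Z x = 0)"
      by (intro allI impI ballI, subst lhs) (simp_all add: *)
  qed
  also have "\<dots> \<longleftrightarrow> ?R"
    unfolding A_def B_def C_def by (intro ball_cong refl) (auto simp: algebra_simps)
  finally show ?thesis .
qed

end

lemma open_box3:
  assumes "open I1" "open I2" "open I3"
  shows "open (box3 I1 I2 I3)"
proof -
  have "box3 I1 I2 I3 = (\<lambda>x. x $ 1) -` I1 \<inter> (\<lambda>x. x $ 2) -` I2 \<inter> (\<lambda>x. x $ 3) -` I3"
    by (auto simp: box3_def)
  then show ?thesis
    using assms by (auto intro!: open_Int open_vimage continuous_intros)
qed

theorem theorem3p23:
  fixes I1 I2 I3 :: "real set" and I :: "(real ^ 3) set"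
    and f1 f2 lam mu :: "real ^ 3 \<Rightarrow> real"
  assumes intervals: "open I1" "is_interval I1" "open I2" "is_interval I2" "open I3" "is_interval I3"
    and I_def: "I = box3 I1 I2 I3"
    and f_smooth: "smooth_on I f1" "smooth_on I f2"
    and f_nonzero: "\<forall>x\<in>I. f1 x \<noteq> 0" "\<forall>x\<in>I. f2 x \<noteq> 0"
    and lam_mu_smooth: "smooth_on I lam" "smooth_on I mu"
    and mu_nonzero: "\<exists>x\<in>I. mu x \<noteq> 0"
    and f_x3: "depends_only_on_x3 I f1" "depends_only_on_x3 I f2"
  shows "almost_eta_ricci_soliton I (metric3 f1 f2) (frame3 f1 f2) (coord_vf 3) (dx 3) lam mu \<longleftrightarrow>
    (\<forall>x\<in>I. lam x = d3 f1 x / f1 x * (d3 f2 x / f2 x + 1)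
                    - d3 (d3 f1) x / f1 x + 2 * (d3 f1 x / f1 x)\<^sup>2) \<and>
    (\<forall>x\<in>I. mu x = - (d3 f1 x / f1 x) * (d3 f2 x / f2 x + 1)
                    - d3 (d3 f2) x / f2 x + 2 * (d3 f2 x / f2 x)\<^sup>2) \<and>
    (\<forall>x\<in>I. (d3 (d3 f1) x - d3 f1 x) / f1 x - 2 * (d3 f1 x / f1 x)\<^sup>2
            = (d3 (d3 f2) x - d3 f2 x) / f2 x - 2 * (d3 f2 x / f2 x)\<^sup>2)"
proof -
  interpret x3_frame I f1 f2
    using open_box3 intervals f_smooth f_nonzero f_x3 unfolding I_def by unfold_locales auto
  show ?thesis
    unfolding soliton_iff[OF lam_mu_smooth mu_nonzero] ball_conj_distrib[symmetric]
  proof (intro ball_cong refl)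
    fix x assume "x \<in> I"
    show "(lam x = p x + p x * q x + (p x)\<^sup>2 - d3 p x
         \<and> lam x = q x + p x * q x + (q x)\<^sup>2 - d3 q x
         \<and> lam x + mu x = (p x)\<^sup>2 - d3 p x + (q x)\<^sup>2 - d3 q x) \<longleftrightarrow>
      (lam x = d3 f1 x / f1 x * (d3 f2 x / f2 x + 1)
                    - d3 (d3 f1) x / f1 x + 2 * (d3 f1 x / f1 x)\<^sup>2 \<and>
       mu x = - (d3 f1 x / f1 x) * (d3 f2 x / f2 x + 1)
                    - d3 (d3 f2) x / f2 x + 2 * (d3 f2 x / f2 x)\<^sup>2 \<and>
       (d3 (d3 f1) x - d3 f1 x) / f1 x - 2 * (d3 f1 x / f1 x)\<^sup>2
            = (d3 (d3 f2) x - d3 f2 x) / f2 x - 2 * (d3 f2 x / f2 x)\<^sup>2)"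
      \<comment> \<open>Substituting p' = f1''/f1 - p^2 and q' = f2''/f2 - q^2, the first equation
        is the formula for \<open>lam\<close>, equating the first two right sides gives
        compatibility, and the third minus the first gives \<open>mu\<close>.\<close>
      unfolding d3_p_q[OF \<open>x \<in> I\<close>] diff_divide_distrib p_def[symmetric] q_def[symmetric]
      by (auto simp: algebra_simps)
  qed
qed

end
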